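(* Suppose the smoothness assumption and the sampling assumption stated in the context hold, and suppose $f$ is bounded from below on the feasible set, i.e. there exists $\bar f>-\infty$ such that $\min_{x\in x^0+\ker(A)} f(x)\ge \bar f$. ($f$ is not assumed convex.) Then the iterates of the random sketch descent (RSD) algorithm satisfy, for every $k\ge 1$, $$\min_{0\le l\le k-1}\mathbf{E}\big[\|\nabla f(x^l)_{\perp}\|_Z^2\big]\;\le\;\frac{2\,(f(x^0)-\bar f)}{k}.$$
   Context: Problem: $\min_{x\in\mathbb{R}^n} f(x)$ subject to $Ax=b$, where $f:\mathbb{R}^n\to\mathbb{R}$ is differentiable, $A\in\mathbb{R}^{m\times n}$ with $m<n$ (the paper: $m\ll n$), and the feasible set is nonempty. A point $x^0$ with $Ax^0=b$ is fixed; the feasible set is $x^0+\ker(A)$. Smoothness assumption: there is a symmetric positive semidefinite matrix $M\in\mathbb{R}^{n\times n}$, positive definite on $\ker(A)$ (i.e. $u^TMu>0$ for all nonzero $u\in\ker(A)$), such that $f(y)\le f(x)+\langle\nabla f(x),y-x\rangle+\tfrac12 (y-x)^TM(y-x)$ for all $x,y\in x^0+\ker(A)$. Sketching: $\mathcal{S}$ is a probability distribution on matrices $S\in\mathbb{R}^{n\times p}$ ($p$ may itself be random). $B^\dagger$ denotes the Moore–Penrose pseudo-inverse of $B$. Put $P_S=I_p-(AS)^\dagger(AS)$, $Z_S=SP_S(P_S^TS^TMSP_S)^\dagger P_S^TS^T\in\mathbb{R}^{n\times n}$, and $Z=\mathbf{E}_{S\sim\mathcal{S}}[Z_S]$. Sampling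 assumption: $Z_S$ has finite mean, and $Z$ is positive definite on $\ker(A)$. Notation: $\|u\|_Z=\sqrt{u^TZu}$ for $u\in\mathbb{R}^n$. For feasible $x$, $\nabla f(x)_\perp$ is the $\ker(A)$-component of $\nabla f(x)$ in the unique orthogonal decomposition $\nabla f(x)=A^T\lambda+\nabla f(x)_\perp$ with $A^T\lambda\in\mathrm{range}(A^T)$, $\nabla f(x)_\perp\in\ker(A)$. RSD algorithm: starting at the feasible $x^0$, at each iteration $k\ge0$ sample $S\sim\mathcal{S}$ (independently of the past) and set $x^{k+1}=x^k-Z_S\nabla f(x^k)$. $\mathbf{E}$ is the expectation over all sampled sketch matrices. *)

theory Defs
  imports "HOL-Probability.Probability" "Jordan_Normal_Form.Matrix"
begin

no_notation Matrix.vec_index (infixl \<open>$\<close> 100)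
no_notation Matrix.scalar_prod (infix \<open>\<bullet>\<close> 70)

text \<open>
  Points of R^n and the fixed-size matrices are vectors and matrices of \<^theory>\<open>HOL-Analysis.Analysis\<close>.
  A sketch has a random number of columns, so the sketches, and everything computed from them,
  are the run-time sized matrices of \<^theory>\<open>Jordan_Normal_Form.Matrix\<close>. The two conversions below
  enumerate the finite index types by one fixed bijection, the same in both directions.
\<close>

definition jnf_of :: "real^'c^'r \<Rightarrow> real mat" where
  "jnf_of B = Matrix.mat CARD('r) CARD('c)
     (\<lambda>(i, j). B $ from_nat_into UNIV i $ from_nat_into UNIV j)"

definition hma_of :: "real mat \<Rightarrow> real^'c^'r" where
  "hma_of B = (\<chi> i j. B $$ (to_nat_on UNIV i, to_nat_on UNIV j))"

lemma to_nat_on_UNIV_less: "to_nat_on UNIV (i :: 'a::finite) < CARD('a)"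
  using to_nat_on_finite[of "UNIV :: 'a set"] by (auto simp: bij_betw_def)

lemma hma_of_jnf_of [simp]: "hma_of (jnf_of B) = (B :: real^'c^'r)"
  by (simp add: hma_of_def jnf_of_def vec_eq_iff countable_finite to_nat_on_UNIV_less)

text \<open>The Moore--Penrose pseudo-inverse, characterised by the four Penrose equations.\<close>

definition is_pinv :: "real mat \<Rightarrow> real mat \<Rightarrow> bool" where
  "is_pinv B X \<longleftrightarrow> X \<in> carrier_mat (dim_col B) (dim_row B) \<and>
     B * X * B = B \<and> X * B * X = X \<and>
     transpose_mat (B * X) = B * X \<and> transpose_mat (X * B) = X * B"

definition pinv :: "real mat \<Rightarrow> real mat" where
  "pinv B = (THE X. is_pinv B X)"

definition sketch_P :: "real^'n^'m \<Rightarrow> real mat \<Rightarrow> real mat" where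
  "sketch_P A S = 1\<^sub>m (dim_col S) - pinv (jnf_of A * S) * (jnf_of A * S)"

definition sketch_Z :: "real^'n^'m \<Rightarrow> real^'n^'n \<Rightarrow> real mat \<Rightarrow> real^'n^'n" where
  "sketch_Z A M S = hma_of
     (S * sketch_P A S
        * pinv (transpose_mat (sketch_P A S) * transpose_mat S * jnf_of M * S * sketch_P A S)
        * transpose_mat (sketch_P A S) * transpose_mat S)"

definition gradient :: "('a::real_inner \<Rightarrow> real) \<Rightarrow> 'a \<Rightarrow> 'a" where
  "gradient f x = (THE g. GDERIV f x :> g)"

definition mat_ker :: "real^'n^'m \<Rightarrow> (real^'n) set" where
  "mat_ker A = {u. A *v u = 0}"

definition pos_def_on :: "(real^'n) set \<Rightarrow> real^'n^'n \<Rightarrow> bool" where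
  "pos_def_on K Q \<longleftrightarrow> (\<forall>u\<in>K. u \<noteq> 0 \<longrightarrow> u \<bullet> (Q *v u) > 0)"

definition ker_part :: "real^'n^'m \<Rightarrow> real^'n \<Rightarrow> real^'n" where
  "ker_part A g = (THE u. u \<in> mat_ker A \<and> (\<exists>l. g = transpose A *v l + u))"

definition mat_norm :: "real^'n^'n \<Rightarrow> real^'n \<Rightarrow> real" where
  "mat_norm Q u = sqrt (u \<bullet> (Q *v u))"

primrec rsd :: "(real^'n \<Rightarrow> real) \<Rightarrow> real^'n^'m \<Rightarrow> real^'n^'n \<Rightarrow> real^'n \<Rightarrow>
    (nat \<Rightarrow> real mat) \<Rightarrow> nat \<Rightarrow> real^'n" where
  "rsd f A M x0 S 0 = x0"
| "rsd f A M x0 S (Suc k) =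
     rsd f A M x0 S k - sketch_Z A M (S k) *v gradient f (rsd f A M x0 S k)"

end

theory Submission
  imports Defs
begin

text \<open>
  For a sketch \<open>S\<close> write \<open>Z\<^sub>S = W N\<^sup>\<dagger> W\<^sup>T\<close> with \<open>W = S P\<^sub>S\<close> and \<open>N = W\<^sup>T M W\<close>. Three identities carry the
  argument: \<open>Z\<^sub>S\<close> is symmetric, \<open>A Z\<^sub>S = 0\<close> and \<open>Z\<^sub>S M Z\<^sub>S = Z\<^sub>S\<close> (\<open>sketch_Z_properties\<close>). The second
  keeps every iterate feasible. The third turns the quadratic upper bound on \<open>f\<close> at the next iterate
  into the descent inequality
  \<open>\<nabla>f(x)\<^sup>T Z\<^sub>S \<nabla>f(x) \<le> 2 (f(x) - f(x - Z\<^sub>S \<nabla>f(x)))\<close>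
  (\<open>sketch_step_descent\<close>), whose left-hand side is nonnegative since \<open>M\<close> is positive
  semidefinite. The first two together give \<open>Z\<^sub>S A\<^sup>T = 0\<close>, so that the gradient may be replaced by its
  kernel component in that left-hand side (\<open>quadratic_form_ker_part\<close>).

  The iterate \<open>x\<^sup>l\<close> depends on the sketches before step \<open>l\<close> only and is therefore independent of the
  sketch \<open>S\<close> of step \<open>l\<close>. By Fubini's theorem (\<open>integral_indep_var_freeze\<close>) the expectation of
  \<open>\<nabla>f(x\<^sup>l)\<^sup>T Z\<^sub>S \<nabla>f(x\<^sup>l)\<close> is that of \<open>\<nabla>f(x\<^sup>l)\<^sup>T Z \<nabla>f(x\<^sup>l)\<close>, the squared \<open>Z\<close>-norm of the kernel
  component. Summing the descent inequality over \<open>l < k\<close> telescopes to \<open>2 (f(x\<^sup>0) - E f(x\<^sup>k))\<close>, at most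
  \<open>2 (f(x\<^sup>0) - fbar)\<close>, and the minimum of \<open>k\<close> numbers is at most their average.

  Two facts behind this are proved along the way. The pseudo-inverse is defined by a definite description,
  so the Moore--Penrose inverse must be shown to exist and to be unique. And the gradient of a
  differentiable function must be shown to be Borel measurable.
\<close>

section \<open>Moore--Penrose inverses of real matrices\<close>

text \<open>
  The side conditions are equations between dimensions, so that the simplifier discharges them
  from the dimensions of the factors, with no intermediate carrier facts.
\<close>

lemma mat_mult_assoc:
  fixes X Y W :: "'a::semiring_0 mat"
  assumes "dim_col X = dim_row Y" "dim_col Y = dim_row W"
  shows "X * Y * W = X * (Y * W)"
  by (rule assoc_mult_mat[of X "dim_row X" "dim_row Y" Y "dim_row W" W "dim_col W"])
    (use assms in auto)

lemma transpose_mat_mult: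
  fixes X Y :: "'a::comm_semiring_0 mat"
  assumes "dim_col X = dim_row Y"
  shows "transpose_mat (X * Y) = transpose_mat Y * transpose_mat X"
  by (rule transpose_mult[of X "dim_row X" "dim_row Y" Y "dim_col Y"]) (use assms in auto)

lemma mat_mult_minus_left:
  fixes X Y W :: "'a::ring mat"
  assumes "dim_col X = dim_row Y" "dim_row Y = dim_row W" "dim_col Y = dim_col W"
  shows "X * (Y - W) = X * Y - X * W"
  by (rule mult_minus_distrib_mat[of X "dim_row X" "dim_row Y" Y "dim_col Y" W])
    (use assms in auto)

lemma mat_mult_minus_right:
  fixes X Y W :: "'a::ring mat"
  assumes "dim_col Y = dim_row X" "dim_row Y = dim_row W" "dim_col Y = dim_col W"
  shows "(Y - W) * X = Y * X - W * X"
  by (rule minus_mult_distrib_mat[of Y "dim_row Y" "dim_col Y" W X "dim_col X"])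
    (use assms in auto)

lemma mat_mult_add_left:
  fixes X Y W :: "'a::ring mat"
  assumes "dim_col X = dim_row Y" "dim_row Y = dim_row W" "dim_col Y = dim_col W"
  shows "X * (Y + W) = X * Y + X * W"
  by (rule mult_add_distrib_mat[of X "dim_row X" "dim_row Y" Y "dim_col Y" W])
    (use assms in auto)

lemma mat_mult_add_right:
  fixes X Y W :: "'a::ring mat"
  assumes "dim_col Y = dim_row X" "dim_row Y = dim_row W" "dim_col Y = dim_col W"
  shows "(Y + W) * X = Y * X + W * X"
  by (rule add_mult_distrib_mat[of Y "dim_row Y" "dim_col Y" W X "dim_col X"])
    (use assms in auto)

lemma mat_eq_0_if_gram_0:
  fixes E :: "real mat"
  assumes "transpose_mat E * E = 0\<^sub>m (dim_col E) (dim_col E)"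
  shows "E = 0\<^sub>m (dim_row E) (dim_col E)"
proof (rule eq_matI)
  fix i j assume ij: "i < dim_row (0\<^sub>m (dim_row E) (dim_col E) :: real mat)"
    "j < dim_col (0\<^sub>m (dim_row E) (dim_col E) :: real mat)"
  have "0 = (transpose_mat E * E) $$ (j, j)"
    using assms ij by simp
  also have "\<dots> = (\<Sum>k<dim_row E. (E $$ (k, j))\<^sup>2)"
    using ij by (simp add: scalar_prod_def power2_eq_square atLeast0LessThan)
  finally have "(\<Sum>k<dim_row E. (E $$ (k, j))\<^sup>2) = 0" ..
  hence "\<forall>k\<in>{..<dim_row E}. (E $$ (k, j))\<^sup>2 = 0"
    by (subst (asm) sum_nonneg_eq_0_iff) auto
  thus "E $$ (i, j) = 0\<^sub>m (dim_row E) (dim_col E) $$ (i, j)"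
    using ij by auto
qed auto

text \<open>
  This is McCoy's lemma from the theory of von Neumann regular rings. An inner inverse of \<open>C\<close> is a
  matrix \<open>G\<close> with \<open>C G C = C\<close>. If \<open>G\<close> is one of \<open>C = B - B F B = B (1 - F B) = (1 - B F) B\<close>, then
  sandwiching \<open>G\<close> between \<open>1 - F B\<close> and \<open>1 - B F\<close> and adding \<open>F\<close> gives an inner inverse of \<open>B\<close>: the
  new summand contributes exactly the missing \<open>B F B\<close>.
\<close>

lemma regular_if_reduction_regular:
  fixes B F G :: "real mat"
  assumes B: "B \<in> carrier_mat n m" and F: "F \<in> carrier_mat m n" and G: "G \<in> carrier_mat m n"
    and reg: "(B - B * F * B) * G * (B - B * F * B) = B - B * F * B"
  shows "B * ((1\<^sub>m m - F * B) * G * (1\<^sub>m n - B * F) + F) * B = B"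
proof -
  note dims = carrier_matD[OF B] carrier_matD[OF F] carrier_matD[OF G]
  have P: "B * (1\<^sub>m m - F * B) = B - B * F * B"
    using dims by (simp add: mat_mult_minus_left mat_mult_assoc)
  have Q: "(1\<^sub>m n - B * F) * B = B - B * F * B"
    using dims by (simp add: mat_mult_minus_right)
  have "B * ((1\<^sub>m m - F * B) * G * (1\<^sub>m n - B * F) + F) * B
      = B * ((1\<^sub>m m - F * B) * G * (1\<^sub>m n - B * F)) * B + B * F * B"
    using dims by (simp add: mat_mult_add_left mat_mult_add_right)
  also have "B * ((1\<^sub>m m - F * B) * G * (1\<^sub>m n - B * F)) * B
      = (B * (1\<^sub>m m - F * B)) * G * ((1\<^sub>m n - B * F) * B)"
    using dims by (simp add: mat_mult_assoc)
  also have "\<dots> = B - B * F * B"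
    unfolding P Q by (rule reg)
  also have "B - B * F * B + B * F * B = B"
    using dims by (intro eq_matI) auto
  finally show ?thesis .
qed

text \<open>
  Gaussian elimination with a pivot \<open>B\<^sub>i\<^sub>j \<noteq> 0\<close>: let \<open>F\<close> have the single nonzero entry
  \<open>1 / B\<^sub>i\<^sub>j\<close> in position \<open>(j, i)\<close>. Then \<open>B F B\<close> is the rank-one matrix (column \<open>j\<close> times row \<open>i\<close>,
  over the pivot), and subtracting it clears row \<open>i\<close> while every zero row stays zero. So
  McCoy's lemma gives an induction on the number of nonzero rows.
\<close>

lemma ex_inner_inverse:
  fixes B :: "real mat"
  assumes "B \<in> carrier_mat n m"
  shows "\<exists>G\<in>carrier_mat m n. B * G * B = B"
  using assms
proof (induction "card {r. r < n \<and> (\<exists>c<m. B $$ (r, c) \<noteq> 0)}" arbitrary: B rule: less_induct)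
  case less
  note B = \<open>B \<in> carrier_mat n m\<close>
  note dims = carrier_matD[OF B]
  show ?case
  proof (cases "\<exists>i<n. \<exists>j<m. B $$ (i, j) \<noteq> 0")
    case False
    have "B = 0\<^sub>m n m"
      using False dims by (intro eq_matI) auto
    thus ?thesis by (intro bexI[of _ "0\<^sub>m m n"]) auto
  next
    case True
    then obtain i j where ij: "i < n" "j < m" "B $$ (i, j) \<noteq> 0" by blast
    define F where "F = Matrix.mat m n (\<lambda>(r, c). if r = j \<and> c = i then 1 / B $$ (i, j) else 0)"
    have F: "F \<in> carrier_mat m n" by (simp add: F_def)
    note dF = carrier_matD[OF F]
    have BF: "(B * F) $$ (r, c) = (if c = i then B $$ (r, j) / B $$ (i, j) else 0)"
      if "r < n" "c < n" for r c
      using that dims dF ij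
      by (auto simp: scalar_prod_def F_def if_distrib[of "\<lambda>x. _ * x"] sum.delta cong: if_cong)
    have BFB: "(B * F * B) $$ (r, c) = B $$ (r, j) / B $$ (i, j) * B $$ (i, c)"
      if "r < n" "c < m" for r c
    proof -
      have "(B * F * B) $$ (r, c) = (\<Sum>k<n. (B * F) $$ (r, k) * B $$ (k, c))"
        using that dims dF by (simp add: scalar_prod_def atLeast0LessThan del: assoc_mult_mat)
      also have "\<dots> = (\<Sum>k<n. if k = i then B $$ (r, j) / B $$ (i, j) * B $$ (i, c) else 0)"
        using that by (intro sum.cong) (auto simp: BF simp del: index_mult_mat)
      finally show ?thesis using ij by simp
    qed
    define C where "C = B - B * F * B"
    have C: "C \<in> carrier_mat n m" using dims dF by (auto simp: C_def)
    have Ce: "C $$ (r, c) = B $$ (r, c) - B $$ (r, j) / B $$ (i, j) * B $$ (i, c)"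
      if "r < n" "c < m" for r c
      using that dims dF by (simp add: C_def BFB del: index_mult_mat(1))
    have sub: "{r. r < n \<and> (\<exists>c<m. C $$ (r, c) \<noteq> 0)} \<subseteq> {r. r < n \<and> (\<exists>c<m. B $$ (r, c) \<noteq> 0)} - {i}"
    proof (intro subsetI DiffI)
      fix r assume r: "r \<in> {r. r < n \<and> (\<exists>c<m. C $$ (r, c) \<noteq> 0)}"
      then obtain c where c: "r < n" "c < m" "C $$ (r, c) \<noteq> 0" by blast
      show "r \<notin> {i}" using c ij by (auto simp: Ce)
      show "r \<in> {r. r < n \<and> (\<exists>c<m. B $$ (r, c) \<noteq> 0)}"
      proof (rule ccontr)
        assume "\<not> ?thesis"
        hence "\<forall>c<m. B $$ (r, c) = 0" using c by blast
        thus False using c ij by (simp add: Ce)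
      qed
    qed
    have "card {r. r < n \<and> (\<exists>c<m. C $$ (r, c) \<noteq> 0)}
        < card {r. r < n \<and> (\<exists>c<m. B $$ (r, c) \<noteq> 0)}"
    proof (intro psubset_card_mono)
      have "i \<in> {r. r < n \<and> (\<exists>c<m. B $$ (r, c) \<noteq> 0)}" using ij by blast
      with sub show "{r. r < n \<and> (\<exists>c<m. C $$ (r, c) \<noteq> 0)}
        \<subset> {r. r < n \<and> (\<exists>c<m. B $$ (r, c) \<noteq> 0)}" by blast
    qed simp
    from less.hyps[OF this C] obtain G where G: "G \<in> carrier_mat m n" "C * G * C = C" by blast
    show ?thesis
      using regular_if_reduction_regular[OF B F G(1)] G(2) unfolding C_def
      by (intro bexI[of _ "(1\<^sub>m m - F * B) * G * (1\<^sub>m n - B * F) + F"])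
        (use dF dims in \<open>auto intro: carrier_matI\<close>)
  qed
qed

text \<open>
  Solve the normal equations: if \<open>N\<close> is an inner inverse of \<open>B\<^sup>T B\<close>, then \<open>Y = N B\<^sup>T\<close> works.
  A factor \<open>B\<^sup>T\<close> on the left can be cancelled because \<open>B\<^sup>T E = 0\<close> with \<open>E = B C\<close> forces
  \<open>E\<^sup>T E = 0\<close>. Since \<open>N\<^sup>T\<close> is an inner inverse of \<open>B\<^sup>T B\<close> as well, \<open>B N B\<^sup>T\<close> equals its transpose
  \<open>B N\<^sup>T B\<^sup>T\<close>.
\<close>

lemma ex_least_squares_inverse:
  fixes B :: "real mat"
  assumes B: "B \<in> carrier_mat n m"
  shows "\<exists>Y\<in>carrier_mat m n. B * Y * B = B \<and> transpose_mat (B * Y) = B * Y"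
proof -
  let ?T = "transpose_mat B"
  have "?T * B \<in> carrier_mat m m" using B by simp
  from ex_inner_inverse[OF this] obtain N
    where N: "N \<in> carrier_mat m m" and NN: "?T * B * N * (?T * B) = ?T * B" by blast
  note dims = carrier_matD[OF B] carrier_matD[OF N]
  have cancel: "B * K * (?T * B) = B"
    if K: "K \<in> carrier_mat m m" and KK: "?T * B * K * (?T * B) = ?T * B" for K
  proof -
    note dims = dims carrier_matD[OF K]
    define E where "E = B * K * (?T * B) - B"
    have E: "E \<in> carrier_mat n m" using dims by (auto simp: E_def)
    have "?T * E = ?T * (B * K * (?T * B)) - ?T * B"
      unfolding E_def using dims by (simp add: mat_mult_minus_left del: assoc_mult_mat)
    also have "?T * (B * K * (?T * B)) = ?T * B"
      using KK dims by (simp add: mat_mult_assoc)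
    also have "?T * B - ?T * B = 0\<^sub>m m m"
      by (rule minus_r_inv_mat) (use dims in \<open>intro carrier_matI; simp\<close>)
    finally have TE: "?T * E = 0\<^sub>m m m" .
    have "E = B * (K * (?T * B) - 1\<^sub>m m)"
      unfolding E_def using dims by (simp add: mat_mult_minus_left mat_mult_assoc)
    hence "transpose_mat E * E = transpose_mat (K * (?T * B) - 1\<^sub>m m) * (?T * E)"
      using dims carrier_matD[OF E] by (simp add: transpose_mat_mult mat_mult_assoc)
    also have "\<dots> = 0\<^sub>m m m" unfolding TE using dims by simp
    finally have "E = 0\<^sub>m n m" using mat_eq_0_if_gram_0[of E] E by simp
    hence "B * K * (?T * B) - B + B = 0\<^sub>m n m + B" by (simp add: E_def)
    moreover have "B * K * (?T * B) - B + B = B * K * (?T * B)"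
      using dims by (intro eq_matI) auto
    ultimately show ?thesis using left_add_zero_mat[OF B] by simp
  qed
  let ?Nt = "transpose_mat N"
  have "transpose_mat (?T * B * N * (?T * B)) = transpose_mat (?T * B)" by (simp only: NN)
  hence NtN: "?T * B * ?Nt * (?T * B) = ?T * B"
    using dims by (simp add: transpose_mat_mult mat_mult_assoc)
  \<comment> \<open>Applying the cancellation to \<open>N\<close> and to \<open>N\<^sup>T\<close>, and transposing the latter.\<close>
  have b1: "B * N * (?T * B) = B" by (rule cancel[OF N NN])
  have b2: "B * ?Nt * (?T * B) = B" by (rule cancel[OF _ NtN]) (use N in simp)
  have "transpose_mat (B * ?Nt * (?T * B)) = ?T" by (simp only: b2)
  hence b3: "?T * B * N * ?T = ?T"
    using dims by (simp add: transpose_mat_mult mat_mult_assoc)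
  have "B * (N * ?T) = (B * ?Nt * (?T * B)) * (N * ?T)" by (simp only: b2)
  also have "\<dots> = B * ?Nt * (?T * B * N * ?T)" using dims by (simp add: mat_mult_assoc)
  also have "\<dots> = B * ?Nt * ?T" by (simp only: b3)
  also have "\<dots> = transpose_mat (B * (N * ?T))"
    using dims by (simp add: transpose_mat_mult mat_mult_assoc)
  finally have "transpose_mat (B * (N * ?T)) = B * (N * ?T)" ..
  moreover have "B * (N * ?T) * B = B" using b1 dims by (simp add: mat_mult_assoc)
  ultimately show ?thesis using dims by (intro bexI[of _ "N * ?T"]) (auto intro: carrier_matI)
qed

text \<open>
  Let \<open>Y\<close> be a least-squares inverse of \<open>B\<close> (so \<open>B Y\<close> is symmetric) and \<open>W\<close> the transpose of one of
  \<open>B\<^sup>T\<close> (so \<open>W B\<close> is symmetric). Then \<open>X = W B Y\<close> satisfies \<open>B X = B Y\<close> and \<open>X B = W B\<close>, hence all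
  four Penrose equations.
\<close>

lemma ex_is_pinv: "\<exists>X. is_pinv B X"
proof -
  define n m where "n = dim_row B" and "m = dim_col B"
  have B: "B \<in> carrier_mat n m" by (simp add: n_def m_def)
  obtain Y where Y: "Y \<in> carrier_mat m n" "B * Y * B = B" "transpose_mat (B * Y) = B * Y"
    using ex_least_squares_inverse[OF B] by blast
  have "transpose_mat B \<in> carrier_mat m n" using B by simp
  from ex_least_squares_inverse[OF this] obtain V where V: "V \<in> carrier_mat n m"
    "transpose_mat B * V * transpose_mat B = transpose_mat B"
    "transpose_mat (transpose_mat B * V) = transpose_mat B * V" by blast
  define W where "W = transpose_mat V"
  have W: "W \<in> carrier_mat m n" using V by (simp add: W_def)
  note dims = carrier_matD[OF B] carrier_matD[OF Y(1)] carrier_matD[OF V(1)]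
    carrier_matD[OF W]
  have "transpose_mat (transpose_mat B * V * transpose_mat B) = B" by (simp add: V)
  hence BWB: "B * (W * B) = B"
    using dims by (simp add: transpose_mat_mult W_def mat_mult_assoc)
  have WB: "transpose_mat (W * B) = W * B"
    using V(3) dims by (simp add: transpose_mat_mult W_def)
  have BYB: "B * (Y * B) = B" using Y dims by (simp add: mat_mult_assoc)
  have BX: "B * (W * B * Y) = B * Y"
  proof -
    have "B * (W * B * Y) = (B * (W * B)) * Y" using dims by (simp add: mat_mult_assoc)
    thus ?thesis by (simp only: BWB)
  qed
  have XB: "W * B * Y * B = W * B"
  proof -
    have "W * B * Y * B = W * (B * (Y * B))" using dims by (simp add: mat_mult_assoc)
    thus ?thesis by (simp only: BYB)
  qed
  have "W * B * Y * B * (W * B * Y) = W * (B * (W * B * Y))"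
    unfolding XB using dims by (simp add: mat_mult_assoc)
  also have "\<dots> = W * B * Y" unfolding BX using dims by (simp add: mat_mult_assoc)
  finally have XBX: "W * B * Y * B * (W * B * Y) = W * B * Y" .
  have "W * B * Y \<in> carrier_mat (dim_col B) (dim_row B)" using dims by (intro carrier_matI) simp_all
  moreover have "B * (W * B * Y) * B = B" unfolding BX by (rule Y)
  moreover have "transpose_mat (B * (W * B * Y)) = B * (W * B * Y)" unfolding BX by (rule Y)
  moreover have "transpose_mat (W * B * Y * B) = W * B * Y * B" unfolding XB by (rule WB)
  ultimately have "is_pinv B (W * B * Y)"
    unfolding is_pinv_def using XBX by blast
  thus ?thesis ..
qed

lemma is_pinv_dims: "dim_row X = dim_col B" "dim_col X = dim_row B" if "is_pinv B X"
  using that by (auto simp: is_pinv_def)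

lemma is_pinvD:
  assumes "is_pinv B X"
  shows "B * X * B = B" "X * B * X = X"
    "transpose_mat (B * X) = B * X" "transpose_mat (X * B) = X * B"
  using assms by (auto simp: is_pinv_def simp del: assoc_mult_mat)

text \<open>
  The symmetric projections agree: \<open>B X = (B Y B X)\<^sup>T = B X B Y = B Y\<close>, and likewise
  \<open>X B = Y B\<close>. Therefore \<open>X = X B X = Y B X = Y B Y = Y\<close>.
\<close>

lemma is_pinv_unique:
  assumes X: "is_pinv B X" and Y: "is_pinv B Y"
  shows "X = Y"
proof -
  note dims = is_pinv_dims[OF X] is_pinv_dims[OF Y]
  note x = is_pinvD[OF X] and y = is_pinvD[OF Y]
  have BX: "B * X = B * Y"
  proof -
    have "B * X = transpose_mat (B * Y * B * X)" using x y by simp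
    also have "B * Y * B * X = (B * Y) * (B * X)" using dims by (simp add: mat_mult_assoc)
    also have "transpose_mat \<dots> = transpose_mat (B * X) * transpose_mat (B * Y)"
      by (rule transpose_mat_mult) (use dims in simp)
    also have "\<dots> = (B * X * B) * Y" unfolding x(3) y(3) using dims by (simp add: mat_mult_assoc)
    finally show ?thesis using x by simp
  qed
  have XB: "X * B = Y * B"
  proof -
    have "X * B = transpose_mat (X * (B * Y * B))" using x y by simp
    also have "X * (B * Y * B) = (X * B) * (Y * B)" using dims by (simp add: mat_mult_assoc)
    also have "transpose_mat \<dots> = transpose_mat (Y * B) * transpose_mat (X * B)"
      by (rule transpose_mat_mult) (use dims in simp)
    also have "\<dots> = Y * (B * X * B)" unfolding x(4) y(4) using dims by (simp add: mat_mult_assoc)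
    finally show ?thesis using x by simp
  qed
  have "X = X * B * X" using x by simp
  also have "\<dots> = Y * (B * X)" unfolding XB using dims by (simp add: mat_mult_assoc)
  also have "\<dots> = Y * B * Y" unfolding BX using dims by (simp add: mat_mult_assoc)
  finally show ?thesis using y by simp
qed

lemma is_pinv_pinv: "is_pinv B (pinv B)"
  unfolding pinv_def using ex_is_pinv is_pinv_unique by (metis theI_unique)

text \<open>Transposing the Penrose equations of \<open>N\<close> gives those of \<open>N\<^sup>T = N\<close>; uniqueness concludes.\<close>

lemma transpose_pinv_symmetric:
  assumes sym: "transpose_mat N = N"
  shows "transpose_mat (pinv N) = pinv N"
proof (rule is_pinv_unique)
  let ?X = "pinv N"
  note p = is_pinvD[OF is_pinv_pinv[of N]]
  have sq: "dim_col N = dim_row N" using arg_cong[OF sym, of dim_row] by simp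
  have dims: "dim_row ?X = dim_row N" "dim_col ?X = dim_row N"
    using is_pinv_dims[OF is_pinv_pinv[of N]] sq by auto
  have a: "N * transpose_mat ?X = transpose_mat (?X * N)"
    "transpose_mat ?X * N = transpose_mat (N * ?X)"
    using dims sq sym by (simp_all add: transpose_mat_mult)
  have b: "transpose_mat (N * ?X * N) = N" "transpose_mat (?X * N * ?X) = transpose_mat ?X"
    using p sym by simp_all
  show "is_pinv N (transpose_mat ?X)"
    unfolding is_pinv_def
  proof (intro conjI)
    show "transpose_mat ?X \<in> carrier_mat (dim_col N) (dim_row N)" using dims sq by auto
    show "N * transpose_mat ?X * N = N"
      using b(1) dims sq sym by (simp add: transpose_mat_mult mat_mult_assoc)
    show "transpose_mat ?X * N * transpose_mat ?X = transpose_mat ?X"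
      using b(2) dims sq sym by (simp add: transpose_mat_mult mat_mult_assoc)
  qed (use p in \<open>simp_all only: a\<close>)
qed (rule is_pinv_pinv)

section \<open>Algebra of the sketched inverse\<close>

lemma hma_of_mult:
  fixes X Y :: "real mat"
  assumes "dim_row X = CARD('r)" "dim_col X = CARD('k)" "dim_row Y = CARD('k)" "dim_col Y = CARD('c)"
  shows "(hma_of (X * Y) :: real^'c^'r) = (hma_of X :: real^'k^'r) ** (hma_of Y :: real^'c^'k)"
proof -
  have bij: "bij_betw (to_nat_on UNIV) (UNIV :: 'k set) {0..<CARD('k)}"
    using to_nat_on_finite[of "UNIV :: 'k set"] by (simp add: atLeast0LessThan)
  have "hma_of (X * Y) $ i $ j = ((hma_of X :: real^'k^'r) ** (hma_of Y :: real^'c^'k)) $ i $ j"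
    for i :: 'r and j :: 'c
  proof -
    have "hma_of (X * Y) $ i $ j
        = (\<Sum>k = 0..<CARD('k). X $$ (to_nat_on UNIV i, k) * Y $$ (k, to_nat_on UNIV j))"
      using assms to_nat_on_UNIV_less[of i] to_nat_on_UNIV_less[of j]
      by (simp add: hma_of_def scalar_prod_def)
    also have "\<dots> = (\<Sum>k\<in>(UNIV :: 'k set).
        X $$ (to_nat_on UNIV i, to_nat_on UNIV k) * Y $$ (to_nat_on UNIV k, to_nat_on UNIV j))"
      by (rule sum.reindex_bij_betw[OF bij, symmetric])
    finally show ?thesis by (simp add: matrix_matrix_mult_def hma_of_def)
  qed
  thus ?thesis by (simp add: Finite_Cartesian_Product.vec_eq_iff)
qed

lemma hma_of_transpose:
  assumes "dim_row X = CARD('r)" "dim_col X = CARD('c)"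
  shows "(hma_of (transpose_mat X) :: real^'r^'c) = transpose (hma_of X :: real^'c^'r)"
  using assms by (simp add: vec_eq_iff hma_of_def transpose_def to_nat_on_UNIV_less)

lemma jnf_of_transpose:
  fixes B :: "real^'c^'r"
  shows "transpose_mat (jnf_of B) = jnf_of (transpose B)"
  by (intro eq_matI) (simp_all add: jnf_of_def transpose_def)

lemma dim_jnf_of [simp]:
  fixes B :: "real^'c^'r"
  shows "dim_row (jnf_of B) = CARD('r)" "dim_col (jnf_of B) = CARD('c)"
  by (simp_all add: jnf_of_def)

text \<open>
  Put \<open>W = S P\<close> and \<open>N = W\<^sup>T M W\<close>, so that \<open>Z = W N\<^sup>\<dagger> W\<^sup>T\<close>. Symmetry of \<open>N\<^sup>\<dagger>\<close> passes to \<open>Z\<close>;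
  \<open>Z M Z = W (N\<^sup>\<dagger> N N\<^sup>\<dagger>) W\<^sup>T = Z\<close> by a Penrose equation; and \<open>A Z = 0\<close> because \<open>P\<close> projects onto the
  kernel of \<open>A S\<close>, so \<open>A W = 0\<close>.
\<close>

lemma sketch_Z_properties:
  fixes A :: "real^'n^'m" and M :: "real^'n^'n" and S :: "real mat"
  assumes rows: "dim_row S = CARD('n)" and M_sym: "transpose M = M"
  shows transpose_sketch_Z: "transpose (sketch_Z A M S) = sketch_Z A M S"
    and sketch_Z_M_sketch_Z: "sketch_Z A M S ** M ** sketch_Z A M S = sketch_Z A M S"
    and mult_sketch_Z: "A ** sketch_Z A M S = 0"
proof -
  define a where "a = jnf_of A * S"
  define P where "P = sketch_P A S"
  have P: "P = 1\<^sub>m (dim_col S) - pinv a * a" by (simp add: P_def sketch_P_def a_def)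
  note pa = is_pinvD[OF is_pinv_pinv[of a]]
  have da: "dim_row a = CARD('m)" "dim_col a = dim_col S" by (simp_all add: a_def)
  have dpa: "dim_row (pinv a) = dim_col S" "dim_col (pinv a) = CARD('m)"
    by (simp_all add: is_pinv_dims[OF is_pinv_pinv] da)
  have dP: "dim_row P = dim_col S" "dim_col P = dim_col S" using da dpa by (simp_all add: P)
  have ca: "a \<in> carrier_mat CARD('m) (dim_col S)" using da by auto
  have aP: "a * P = 0\<^sub>m CARD('m) (dim_col S)"
  proof -
    have "a * P = a - a * (pinv a * a)"
      unfolding P using dpa da by (simp add: mat_mult_minus_left)
    also have "a * (pinv a * a) = a" using pa da dpa by (simp add: mat_mult_assoc[symmetric])
    finally show ?thesis using minus_r_inv_mat[OF ca] by simp
  qed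
  define W where "W = S * P"
  have W: "dim_row W = CARD('n)" "dim_col W = dim_col S" using rows dP by (simp_all add: W_def)
  have AW: "jnf_of A * W = 0\<^sub>m CARD('m) (dim_col S)"
    using aP rows dP by (simp add: W_def a_def mat_mult_assoc)
  define m where "m = jnf_of M"
  have dm: "dim_row m = CARD('n)" "dim_col m = CARD('n)" by (simp_all add: m_def)
  have m_sym: "transpose_mat m = m" by (simp add: m_def jnf_of_transpose M_sym)
  define N where "N = transpose_mat W * m * W"
  have N_eq: "transpose_mat P * transpose_mat S * m * S * P = N"
    using rows dP dm by (simp add: N_def W_def transpose_mat_mult mat_mult_assoc)
  have dN: "dim_row N = dim_col S" "dim_col N = dim_col S" using W by (simp_all add: N_def)
  have N_sym: "transpose_mat N = N"
    using W dm m_sym by (simp add: N_def transpose_mat_mult mat_mult_assoc)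
  define R where "R = pinv N"
  note pN = is_pinvD[OF is_pinv_pinv[of N], folded R_def]
  have dR: "dim_row R = dim_col S" "dim_col R = dim_col S"
    by (simp_all add: R_def is_pinv_dims[OF is_pinv_pinv] dN)
  have R_sym: "transpose_mat R = R" using transpose_pinv_symmetric[OF N_sym] by (simp add: R_def)
  define z where "z = W * R * transpose_mat W"
  have dz: "dim_row z = CARD('n)" "dim_col z = CARD('n)" using W by (simp_all add: z_def)
  have Z: "sketch_Z A M S = hma_of z"
    unfolding sketch_Z_def P_def[symmetric] m_def[symmetric] N_eq
    using rows dP dR W by (simp add: z_def W_def R_def[symmetric] transpose_mat_mult mat_mult_assoc)
  have z_sym: "transpose_mat z = z"
    using W dR R_sym by (simp add: z_def transpose_mat_mult mat_mult_assoc)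
  have zmz: "z * m * z = z"
  proof -
    have "z * m * z = W * (R * N * R) * transpose_mat W"
      using W dR dm by (simp add: z_def N_def mat_mult_assoc)
    also have "R * N * R = R" by (rule pN)
    finally show ?thesis by (simp add: z_def)
  qed
  have Az: "jnf_of A * z = 0\<^sub>m CARD('m) CARD('n)"
  proof -
    have "jnf_of A * z = (jnf_of A * W) * (R * transpose_mat W)"
      using W dR by (simp add: z_def mat_mult_assoc)
    thus ?thesis unfolding AW using W dR by simp
  qed
  show "transpose (sketch_Z A M S) = sketch_Z A M S"
    unfolding Z by (subst hma_of_transpose[symmetric]) (simp_all add: dz z_sym)
  have "hma_of (z * m * z) = (hma_of (z * m) :: real^'n^'n) ** (hma_of z :: real^'n^'n)"
    by (rule hma_of_mult) (simp_all add: dz dm)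
  also have "(hma_of (z * m) :: real^'n^'n) = (hma_of z :: real^'n^'n) ** (hma_of m :: real^'n^'n)"
    by (rule hma_of_mult) (simp_all add: dz dm)
  finally have "hma_of (z * m * z) = (hma_of z :: real^'n^'n) ** M ** (hma_of z :: real^'n^'n)"
    by (simp add: m_def)
  thus "sketch_Z A M S ** M ** sketch_Z A M S = sketch_Z A M S"
    by (simp add: Z zmz)
  have "hma_of (jnf_of A * z) = (hma_of (jnf_of A) :: real^'n^'m) ** (hma_of z :: real^'n^'n)"
    by (rule hma_of_mult) (simp_all add: dz)
  hence "hma_of (jnf_of A * z) = A ** (hma_of z :: real^'n^'n)" by simp
  moreover have "(hma_of (0\<^sub>m CARD('m) CARD('n)) :: real^'n^'m) = 0"
    by (simp add: hma_of_def Finite_Cartesian_Product.vec_eq_iff to_nat_on_UNIV_less)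
  ultimately show "A ** sketch_Z A M S = 0" by (simp only: Z Az)
qed

section \<open>Measurability of the gradient\<close>

lemma GDERIV_gradient:
  fixes f :: "'a::euclidean_space \<Rightarrow> real"
  assumes "f differentiable (at y)"
  shows "GDERIV f y :> gradient f y"
proof -
  obtain F where F: "(f has_derivative F) (at y)"
    using assms by (auto simp: differentiable_def)
  define g where "g = (\<Sum>e\<in>Basis. F e *\<^sub>R e)"
  have lin: "linear F" by (rule has_derivative_linear[OF F])
  have "F h = h \<bullet> g" for h
  proof -
    have "F h = F (\<Sum>e\<in>Basis. (h \<bullet> e) *\<^sub>R e)" by (simp add: euclidean_representation)
    also have "\<dots> = h \<bullet> g"
      by (simp add: linear_sum[OF lin] linear_cmul[OF lin] g_def inner_sum_right mult.commute)
    finally show ?thesis .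
  qed
  hence "F = (\<lambda>h. h \<bullet> g)" by blast
  hence g: "GDERIV f y :> g" using F by (simp add: gderiv_def)
  have "g' = g" if g': "GDERIV f y :> g'" for g'
  proof -
    have "(\<lambda>h. h \<bullet> g') = (\<lambda>h. h \<bullet> g)"
      using has_derivative_unique[OF g'[unfolded gderiv_def] g[unfolded gderiv_def]] .
    hence "(g' - g) \<bullet> g' = (g' - g) \<bullet> g" by (rule fun_cong)
    hence "(g' - g) \<bullet> (g' - g) = 0" by (simp add: inner_diff_right)
    thus ?thesis by simp
  qed
  with g show ?thesis unfolding gradient_def by (rule theI)
qed

lemma gradient_inner_LIMSEQ:
  fixes f :: "'a::euclidean_space \<Rightarrow> real"
  assumes "f differentiable (at y)"
  shows "(\<lambda>n. (f (y + inverse (real (Suc n)) *\<^sub>R v) - f y) / inverse (real (Suc n)))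
    \<longlonglongrightarrow> gradient f y \<bullet> v"
proof -
  have "(f has_derivative (\<lambda>h. h \<bullet> gradient f y)) (at (y + 0 *\<^sub>R v))"
    using GDERIV_gradient[OF assms] by (simp add: gderiv_def)
  moreover have "((\<lambda>t. y + t *\<^sub>R v) has_derivative (\<lambda>t. t *\<^sub>R v)) (at 0)"
    by (auto intro!: derivative_eq_intros)
  ultimately have "((\<lambda>t. f (y + t *\<^sub>R v)) has_derivative (\<lambda>t. (t *\<^sub>R v) \<bullet> gradient f y)) (at 0)"
    by (rule has_derivative_compose[rotated])
  hence "((\<lambda>t. f (y + t *\<^sub>R v)) has_real_derivative (gradient f y \<bullet> v)) (at 0)"
    by (simp add: has_field_derivative_def inner_commute mult.commute[of "inner _ _"]
        mult_commute_abs)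
  hence "((\<lambda>h. (f (y + h *\<^sub>R v) - f y) / h) \<longlongrightarrow> gradient f y \<bullet> v) (at 0)"
    by (simp add: DERIV_def)
  moreover have "filterlim (\<lambda>n. inverse (real (Suc n))) (at 0) sequentially"
    unfolding filterlim_at using LIMSEQ_inverse_real_of_nat by auto
  ultimately show ?thesis by (rule filterlim_compose)
qed

text \<open>
  The gradient may be discontinuous, but each of its components is a pointwise limit of difference
  quotients, which are continuous functions of the base point.
\<close>

lemma borel_measurable_gradient:
  fixes f :: "'a::euclidean_space \<Rightarrow> real"
  assumes diff: "\<And>y. f differentiable (at y)"
  shows "gradient f \<in> borel_measurable borel"
proof (subst borel_measurable_euclidean_space, intro ballI)
  fix e :: 'a assume "e \<in> Basis"
  have "continuous_on UNIV f"
    using diff by (simp add: continuous_at_imp_continuous_on differentiable_imp_continuous_within)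
  hence f: "f \<in> borel_measurable borel" by (rule borel_measurable_continuous_onI)
  have "(\<lambda>y. (f (y + inverse (real (Suc n)) *\<^sub>R e) - f y) / inverse (real (Suc n)))
      \<in> borel_measurable borel" for n
    using f by measurable
  thus "(\<lambda>y. gradient f y \<bullet> e) \<in> borel_measurable borel"
    by (rule borel_measurable_LIMSEQ_real[rotated]) (rule gradient_inner_LIMSEQ[OF diff])
qed

section \<open>The kernel component of a vector\<close>

lemma inner_matrix_transpose:
  fixes Q :: "real^'c^'r"
  shows "u \<bullet> (Q *v v) = (transpose Q *v u) \<bullet> v"
  by (simp add: dot_lmul_matrix transpose_matrix_vector)

text \<open>
  The kernel of \<open>A\<close> is the orthogonal complement of the range of \<open>A\<^sup>T\<close>, so the decomposition
  exists and is unique, which is what makes the description in \<^const>\<open>ker_part\<close> proper.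
\<close>

lemma ker_part_decomposition:
  fixes A :: "real^'n^'m"
  shows "ker_part A g \<in> mat_ker A \<and> (\<exists>l. g = transpose A *v l + ker_part A g)"
proof -
  let ?R = "range (\<lambda>l. transpose A *v l)"
  have sub: "subspace ?R" by (intro linear_subspace_image subspace_UNIV matrix_vector_mul_linear)
  obtain r u where ru: "r \<in> span ?R" "\<And>w. w \<in> span ?R \<Longrightarrow> u \<bullet> w = 0" "g = r + u"
    using orthogonal_subspace_decomp_exists[of ?R g] by (metis Linear_Algebra.orthogonal_def)
  have "(A *v u) \<bullet> l = 0" for l
  proof -
    have "u \<bullet> (transpose A *v l) = 0" by (intro ru(2) span_base rangeI)
    thus ?thesis by (subst (asm) inner_matrix_transpose)
        (simp only: Finite_Cartesian_Product.transpose_transpose)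
  qed
  from this[of "A *v u"] have u: "A *v u = 0" by simp
  from ru(1) sub obtain l where l: "r = transpose A *v l" by (auto simp: span_eq_iff[THEN iffD2])
  have "u' = u" if u': "u' \<in> mat_ker A" and l': "g = transpose A *v l' + u'" for u' l'
  proof -
    have eq: "u' - u = transpose A *v (l - l')"
      using ru(3) l l' by (simp add: matrix_vector_mult_diff_distrib algebra_simps)
    have "(u' - u) \<bullet> (u' - u) = (A *v (u' - u)) \<bullet> (l - l')"
      by (subst (2) eq, subst inner_matrix_transpose)
        (simp only: Finite_Cartesian_Product.transpose_transpose)
    also have "A *v (u' - u) = 0"
      using u u' by (simp add: mat_ker_def matrix_vector_mult_diff_distrib)
    finally show ?thesis by simp
  qed
  hence "\<exists>!u. u \<in> mat_ker A \<and> (\<exists>l. g = transpose A *v l + u)"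
    using u l ru(3) by (intro ex1I[of _ u]) (auto simp: mat_ker_def)
  thus ?thesis unfolding ker_part_def by (rule theI')
qed

text \<open>
  A symmetric \<open>Q\<close> with \<open>A Q = 0\<close> also satisfies \<open>Q A\<^sup>T = 0\<close>, so the component of \<open>g\<close> in the range
  of \<open>A\<^sup>T\<close> is invisible to the quadratic form.
\<close>

lemma quadratic_form_ker_part:
  fixes A :: "real^'n^'m" and Q :: "real^'n^'n"
  assumes sym: "transpose Q = Q" and AQ: "A ** Q = 0"
  shows "ker_part A g \<bullet> (Q *v ker_part A g) = g \<bullet> (Q *v g)"
proof -
  define u where "u = ker_part A g"
  obtain l where g: "g = transpose A *v l + u"
    using ker_part_decomposition[of A g] by (auto simp: u_def)
  have "Q ** transpose A = transpose (A ** Q)" by (simp add: matrix_transpose_mul sym)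
  also have "\<dots> = 0" unfolding AQ by (simp add: transpose_def Finite_Cartesian_Product.vec_eq_iff)
  finally have QA: "Q *v (transpose A *v l) = 0"
    by (simp only: matrix_vector_mul_assoc matrix_vector_mult_0)
  have "(transpose A *v l) \<bullet> (Q *v u) = (Q *v (transpose A *v l)) \<bullet> u"
    by (simp add: inner_matrix_transpose sym)
  thus ?thesis unfolding u_def[symmetric]
    by (subst (1 2) g) (simp add: matrix_vector_right_distrib QA inner_add_left
        del: transpose_matrix_vector)
qed

section \<open>One step of the descent method\<close>

text \<open>
  This is \<open>Z M Z = Z\<close> read as a quadratic form: the squared \<open>M\<close>-length of the step \<open>Z g\<close> is
  the decrease \<open>g\<^sup>T Z g\<close> that the linear term of the smoothness bound promises.
\<close>

lemma sketch_step_M_length: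
  fixes A :: "real^'n^'m"
  assumes rows: "dim_row T = CARD('n)" and M_sym: "transpose M = M"
  shows "(sketch_Z A M T *v g) \<bullet> (M *v (sketch_Z A M T *v g)) = g \<bullet> (sketch_Z A M T *v g)"
proof -
  let ?Q = "sketch_Z A M T"
  have "(?Q *v g) \<bullet> (M *v (?Q *v g)) = g \<bullet> (?Q *v (M *v (?Q *v g)))"
    by (simp only: inner_matrix_transpose[of g ?Q] transpose_sketch_Z[OF rows M_sym])
  also have "\<dots> = g \<bullet> (?Q *v g)"
    by (simp add: matrix_vector_mul_assoc matrix_mul_assoc sketch_Z_M_sketch_Z[OF rows M_sym])
  finally show ?thesis .
qed

lemma sketch_Z_quadratic_nonneg:
  fixes A :: "real^'n^'m"
  assumes rows: "dim_row T = CARD('n)" and M_sym: "transpose M = M"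
    and M_psd: "\<And>u. 0 \<le> u \<bullet> (M *v u)"
  shows "0 \<le> g \<bullet> (sketch_Z A M T *v g)"
  using M_psd[of "sketch_Z A M T *v g"] by (simp only: sketch_step_M_length[OF rows M_sym])

lemma sketch_step_feasible:
  fixes A :: "real^'n^'m"
  assumes rows: "dim_row T = CARD('n)" and M_sym: "transpose M = M"
    and y: "A *v y = b"
  shows "A *v (y - sketch_Z A M T *v g) = b"
  using y mult_sketch_Z[OF rows M_sym, of A]
  by (simp add: matrix_vector_mult_diff_distrib matrix_vector_mul_assoc)

text \<open>
  At \<open>z = y - Z g\<close> the linear term of the smoothness bound is \<open>- g\<^sup>T Z g\<close> and the quadratic term is
  half of \<open>g\<^sup>T Z g\<close>, so half of the promised decrease is realised.
\<close>

lemma sketch_step_descent: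
  fixes A :: "real^'n^'m"
  assumes rows: "dim_row T = CARD('n)" and M_sym: "transpose M = M"
    and smooth: "\<And>y z. A *v y = b \<Longrightarrow> A *v z = b \<Longrightarrow>
      f z \<le> f y + gradient f y \<bullet> (z - y) + 1 / 2 * ((z - y) \<bullet> (M *v (z - y)))"
    and y: "A *v y = b"
  shows "gradient f y \<bullet> (sketch_Z A M T *v gradient f y)
    \<le> 2 * (f y - f (y - sketch_Z A M T *v gradient f y))"
proof -
  have neg: "M *v - w = - (M *v w)" for w
    using matrix_vector_mult_diff_distrib[of M 0 w] by simp
  show ?thesis
    using smooth[OF y sketch_step_feasible[OF rows M_sym y, of "gradient f y"]]
      sketch_step_M_length[OF rows M_sym, of A "gradient f y"]
    by (simp add: neg)
qed

section \<open>Expectations along the iteration\<close>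

lemma bounded_linear_quadratic_form:
  "bounded_linear (\<lambda>Q :: real^'n^'n. v \<bullet> (Q *v v))"
  by (intro linear_conv_bounded_linear[THEN iffD1] linearI)
    (simp_all add: matrix_vector_mult_add_rdistrib inner_add_right scaleR_matrix_vector_assoc[symmetric])

lemma borel_measurable_matrix_vector_mult:
  fixes Q :: "'a \<Rightarrow> real^'c^'r"
  assumes "Q \<in> borel_measurable N" "v \<in> borel_measurable N"
  shows "(\<lambda>w. Q w *v v w) \<in> borel_measurable N"
  using assms
  by (rule borel_measurable_continuous_Pair)
    (auto simp: matrix_vector_mult_def intro!: continuous_intros)

text \<open>
  The iterate \<open>l\<close> reads only the first \<open>l\<close> sketches, so it is measurable with respect to any family
  of coordinates that contains them.
\<close>

lemma rsd_measurable:
  fixes f :: "real^'n \<Rightarrow> real" and A :: "real^'n^'m"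
  assumes Z: "sketch_Z A M \<in> borel_measurable D" and g: "gradient f \<in> borel_measurable borel"
    and "{..<l} \<subseteq> J"
  shows "(\<lambda>s. rsd f A M x0 s l) \<in> borel_measurable (PiM J (\<lambda>_. D))"
  using assms(3)
proof (induction l)
  case (Suc l)
  hence IH: "(\<lambda>s. rsd f A M x0 s l) \<in> borel_measurable (PiM J (\<lambda>_. D))" and l: "l \<in> J"
    by (auto simp: lessThan_Suc)
  have "(\<lambda>s. sketch_Z A M (s l)) \<in> borel_measurable (PiM J (\<lambda>_. D))"
    using measurable_compose[OF measurable_component_singleton[OF l] Z] .
  moreover have "(\<lambda>s. gradient f (rsd f A M x0 s l)) \<in> borel_measurable (PiM J (\<lambda>_. D))"
    using measurable_compose[OF IH g] .
  ultimately show ?case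
    using IH by (auto intro!: borel_measurable_diff borel_measurable_matrix_vector_mult)
qed simp

lemma rsd_cong:
  "(\<And>i. i < l \<Longrightarrow> s i = t i) \<Longrightarrow> rsd f A M x0 s l = rsd f A M x0 t l"
  by (induction l) auto

text \<open>
  Conditioning on \<open>X\<close> without conditional expectations: under independence the joint law is a product,
  and Fubini's theorem allows \<open>T\<close> to be averaged over a fresh copy \<open>\<omega>'\<close> of the sample point. The two
  variables take values in one type because \<^const>\<open>prob_space.indep_var\<close> asks for it.
\<close>

lemma (in prob_space) integral_indep_var_freeze:
  fixes h :: "'b \<times> 'b \<Rightarrow> real"
  assumes ind: "indep_var N X D T"
    and h: "h \<in> borel_measurable (N \<Otimes>\<^sub>M D)"
    and int: "integrable M (\<lambda>\<omega>. h (X \<omega>, T \<omega>))"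
  shows "integrable M (\<lambda>\<omega>. \<integral>\<omega>'. h (X \<omega>, T \<omega>') \<partial>M)"
    and "(\<integral>\<omega>. (\<integral>\<omega>'. h (X \<omega>, T \<omega>') \<partial>M) \<partial>M) = (\<integral>\<omega>. h (X \<omega>, T \<omega>) \<partial>M)"
proof -
  have X: "X \<in> measurable M N" and T: "T \<in> measurable M D"
    using ind by (auto dest: indep_var_rv1 indep_var_rv2)
  interpret X: prob_space "distr M N X" by (rule prob_space_distr[OF X])
  interpret T: prob_space "distr M D T" by (rule prob_space_distr[OF T])
  interpret pair_sigma_finite "distr M N X" "distr M D T" ..
  have XT: "(\<lambda>\<omega>. (X \<omega>, T \<omega>)) \<in> measurable M (N \<Otimes>\<^sub>M D)" using X T by measurable
  have prod: "distr M N X \<Otimes>\<^sub>M distr M D T = distr M (N \<Otimes>\<^sub>M D) (\<lambda>\<omega>. (X \<omega>, T \<omega>))"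
    using ind indep_var_distribution_eq by blast
  have inth: "integrable (distr M N X \<Otimes>\<^sub>M distr M D T) h"
    unfolding prod by (subst integrable_distr_eq[OF XT h]) (rule int)
  have inner: "(\<integral>\<omega>'. h (X \<omega>, T \<omega>') \<partial>M) = (\<integral>t. h (X \<omega>, t) \<partial>distr M D T)"
    if "\<omega> \<in> space M" for \<omega>
    by (rule integral_distr[OF T, symmetric])
      (rule measurable_compose[OF measurable_Pair1'[OF measurable_space[OF X that]] h])
  have meas: "(\<lambda>y. \<integral>t. h (y, t) \<partial>distr M D T) \<in> borel_measurable N"
    by (rule T.borel_measurable_lebesgue_integral) (use h in simp)
  have "integrable M (\<lambda>\<omega>. \<integral>t. h (X \<omega>, t) \<partial>distr M D T)"
    using integrable_fst'[OF inth] by (simp add: integrable_distr_eq[OF X meas])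
  thus "integrable M (\<lambda>\<omega>. \<integral>\<omega>'. h (X \<omega>, T \<omega>') \<partial>M)"
    by (simp add: inner cong: Bochner_Integration.integrable_cong)
  have "(\<integral>\<omega>. (\<integral>t. h (X \<omega>, t) \<partial>distr M D T) \<partial>M) = (\<integral>\<omega>. h (X \<omega>, T \<omega>) \<partial>M)"
    using integral_fst'[OF inth]
    by (simp add: integral_distr[OF X meas] prod integral_distr[OF XT h])
  thus "(\<integral>\<omega>. (\<integral>\<omega>'. h (X \<omega>, T \<omega>') \<partial>M) \<partial>M) = (\<integral>\<omega>. h (X \<omega>, T \<omega>) \<partial>M)"
    by (simp add: inner cong: Bochner_Integration.integral_cong)
qed

section \<open>The convergence rate\<close>

theorem theorem3p1:
  fixes f :: "real^'n \<Rightarrow> real"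
    and A :: "real^'n^'m"
    and b :: "real^'m"
    and x0 :: "real^'n"
    and M Z :: "real^'n^'n"
    and fbar :: real
    and D :: "real mat measure"
    and \<Omega> :: "'w measure"
    and S :: "nat \<Rightarrow> 'w \<Rightarrow> real mat"
    and x :: "nat \<Rightarrow> 'w \<Rightarrow> real^'n"
    and k :: nat
  assumes dims: "CARD('m) < CARD('n)"
    and f_diff: "\<And>y. f differentiable (at y)"
    and x0_feasible: "A *v x0 = b"
    and M_sym: "transpose M = M"
    and M_psd: "\<And>u. u \<bullet> (M *v u) \<ge> 0"
    and M_pd_ker: "pos_def_on (mat_ker A) M"
    and smooth: "\<And>y z. A *v y = b \<Longrightarrow> A *v z = b \<Longrightarrow>
      f z \<le> f y + gradient f y \<bullet> (z - y) + 1 / 2 * ((z - y) \<bullet> (M *v (z - y)))"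
    and D_prob: "prob_space D"
    and D_rows: "\<And>T. T \<in> space D \<Longrightarrow> dim_row T = CARD('n)"
    and Z_finite_mean: "integrable D (sketch_Z A M)"
    and Z_def: "Z = (\<integral>T. sketch_Z A M T \<partial>D)"
    and Z_pd_ker: "pos_def_on (mat_ker A) Z"
    and f_bounded_below: "\<And>y. A *v y = b \<Longrightarrow> fbar \<le> f y"
    and \<Omega>_prob: "prob_space \<Omega>"
    and S_indep: "prob_space.indep_vars \<Omega> (\<lambda>_. D) S UNIV"
    and S_distr: "\<And>i. distr \<Omega> D (S i) = D"
    and x_def: "\<And>l \<omega>. x l \<omega> = rsd f A M x0 (\<lambda>i. S i \<omega>) l"
    and k_ge_1: "k \<ge> 1"
  shows "(\<forall>l<k. integrable \<Omega> (\<lambda>\<omega>. (mat_norm Z (ker_part A (gradient f (x l \<omega>))))\<^sup>2)) \<and>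
    (MIN l\<in>{0..k-1}. \<integral>\<omega>. (mat_norm Z (ker_part A (gradient f (x l \<omega>))))\<^sup>2 \<partial>\<Omega>)
      \<le> 2 * (f x0 - fbar) / real k"
proof -
  interpret \<Omega>: prob_space \<Omega> by (rule \<Omega>_prob)
  have S_meas: "S i \<in> measurable \<Omega> D" for i
    using S_indep unfolding \<Omega>.indep_vars_def by blast
  have rows: "dim_row (S i \<omega>) = CARD('n)" if "\<omega> \<in> space \<Omega>" for i \<omega>
    using D_rows measurable_space[OF S_meas that] .
  have Z_meas: "sketch_Z A M \<in> borel_measurable D" using Z_finite_mean by simp
  have g_meas: "gradient f \<in> borel_measurable borel" by (rule borel_measurable_gradient[OF f_diff])
  have "continuous_on UNIV f"
    using f_diff by (simp add: continuous_at_imp_continuous_on differentiable_imp_continuous_within)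
  hence f_meas: "f \<in> borel_measurable borel" by (rule borel_measurable_continuous_onI)

  \<comment> \<open>The iterate as a function \<open>\<Phi> l\<close> of the past sketches alone, which makes it independent of the
    sketch of step \<open>l\<close>.\<close>
  define \<Phi> where "\<Phi> l s = rsd f A M x0 s l" for l s
  have \<Phi>_meas: "\<Phi> l \<in> borel_measurable (PiM {..<l} (\<lambda>_. D))" for l
    unfolding \<Phi>_def by (rule rsd_measurable[OF Z_meas g_meas order.refl])
  have x_\<Phi>: "x l = (\<lambda>\<omega>. \<Phi> l (restrict (\<lambda>i. S i \<omega>) {..<l}))" for l
    unfolding \<Phi>_def x_def by (intro ext rsd_cong) simp
  have x_meas: "x l \<in> borel_measurable \<Omega>" for l
    unfolding x_\<Phi> by (rule measurable_compose[OF measurable_restrict \<Phi>_meas]) (rule S_meas)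

  have x_Suc: "x (Suc l) \<omega> = x l \<omega> - sketch_Z A M (S l \<omega>) *v gradient f (x l \<omega>)" for l \<omega>
    by (simp add: x_def)
  have feasible: "A *v x l \<omega> = b" if \<omega>: "\<omega> \<in> space \<Omega>" for l \<omega>
  proof (induction l)
    case 0
    show ?case by (simp add: x_def x0_feasible)
  next
    case (Suc l)
    show ?case unfolding x_Suc by (rule sketch_step_feasible[OF rows[OF \<omega>] M_sym Suc])
  qed

  define h where "h = (\<lambda>(y, T). gradient f y \<bullet> (sketch_Z A M T *v gradient f y))"
  have h_meas: "h \<in> borel_measurable (borel \<Otimes>\<^sub>M D)"
  proof -
    have 1: "(\<lambda>p. gradient f (fst p)) \<in> borel_measurable (borel \<Otimes>\<^sub>M D)"
      by (rule measurable_compose[OF measurable_fst g_meas])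
    have 2: "(\<lambda>p. sketch_Z A M (snd p)) \<in> borel_measurable (borel \<Otimes>\<^sub>M D)"
      by (rule measurable_compose[OF measurable_snd Z_meas])
    show ?thesis unfolding h_def case_prod_beta
      by (intro borel_measurable_inner borel_measurable_matrix_vector_mult 1 2)
  qed
  have h_nonneg: "0 \<le> h (x l \<omega>, S l \<omega>)" if \<omega>: "\<omega> \<in> space \<Omega>" for l \<omega>
    unfolding h_def prod.case by (rule sketch_Z_quadratic_nonneg[OF rows[OF \<omega>] M_sym M_psd])
  have descent: "h (x l \<omega>, S l \<omega>) \<le> 2 * (f (x l \<omega>) - f (x (Suc l) \<omega>))"
    if \<omega>: "\<omega> \<in> space \<Omega>" for l \<omega>
    unfolding h_def x_Suc prod.case
    by (rule sketch_step_descent[where A = A and b = b and M = M and f = f,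
          OF rows[OF \<omega>] M_sym smooth feasible[OF \<omega>]])

  have f_upper: "f (x l \<omega>) \<le> f x0" if \<omega>: "\<omega> \<in> space \<Omega>" for l \<omega>
  proof (induction l)
    case 0
    show ?case by (simp add: x_def)
  next
    case (Suc l)
    show ?case using Suc h_nonneg[OF \<omega>, of l] descent[OF \<omega>, of l] by simp
  qed
  \<comment> \<open>The values of \<open>f\<close> lie between \<open>fbar\<close> and \<open>f x0\<close> on every path. This boundedness supplies all
    integrability: the gradient itself may be unbounded along the iterates.\<close>
  have f_int: "integrable \<Omega> (\<lambda>\<omega>. f (x l \<omega>))" for l
  proof (rule \<Omega>.integrable_const_bound[where B = "\<bar>fbar\<bar> + \<bar>f x0\<bar>"])
    show "AE \<omega> in \<Omega>. norm (f (x l \<omega>)) \<le> \<bar>fbar\<bar> + \<bar>f x0\<bar>"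
    proof (rule AE_I2)
      fix \<omega> assume "\<omega> \<in> space \<Omega>"
      thus "norm (f (x l \<omega>)) \<le> \<bar>fbar\<bar> + \<bar>f x0\<bar>"
        using f_upper[of \<omega> l] f_bounded_below[OF feasible, of \<omega> l] by auto
    qed
  qed (rule measurable_compose[OF x_meas f_meas])
  have h_int: "integrable \<Omega> (\<lambda>\<omega>. h (x l \<omega>, S l \<omega>))" for l
  proof (rule Bochner_Integration.integrable_bound)
    show "integrable \<Omega> (\<lambda>\<omega>. 2 * (f (x l \<omega>) - f (x (Suc l) \<omega>)))"
      by (intro integrable_mult_right Bochner_Integration.integrable_diff f_int)
    have "(\<lambda>\<omega>. (x l \<omega>, S l \<omega>)) \<in> measurable \<Omega> (borel \<Otimes>\<^sub>M D)"
      by (intro measurable_Pair x_meas S_meas)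
    thus "(\<lambda>\<omega>. h (x l \<omega>, S l \<omega>)) \<in> borel_measurable \<Omega>"
      using h_meas by (rule measurable_compose)
    show "AE \<omega> in \<Omega>. norm (h (x l \<omega>, S l \<omega>)) \<le> norm (2 * (f (x l \<omega>) - f (x (Suc l) \<omega>)))"
    proof (rule AE_I2)
      fix \<omega> assume \<omega>: "\<omega> \<in> space \<Omega>"
      show "norm (h (x l \<omega>, S l \<omega>)) \<le> norm (2 * (f (x l \<omega>) - f (x (Suc l) \<omega>)))"
        using h_nonneg[OF \<omega>, of l] descent[OF \<omega>, of l] by simp
    qed
  qed

  \<comment> \<open>For a fixed iterate, the squared norm in the theorem is the average of the quadratic form \<open>h\<close>
    over a single sketch: the kernel component may replace the gradient for each sketch separately, and the
    form is linear in the matrix. The average is nonnegative, so the square root in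
    \<^const>\<open>mat_norm\<close> is undone by squaring.\<close>
  define q where "q l \<omega> = (mat_norm Z (ker_part A (gradient f (x l \<omega>))))\<^sup>2" for l \<omega>
  have q_eq: "q l \<omega> = (\<integral>T. h (x l \<omega>, T) \<partial>D)" for l \<omega>
  proof -
    let ?g = "gradient f (x l \<omega>)"
    let ?u = "ker_part A ?g"
    have "?u \<bullet> (Z *v ?u) = (\<integral>T. ?u \<bullet> (sketch_Z A M T *v ?u) \<partial>D)"
      unfolding Z_def
      by (rule integral_bounded_linear[OF bounded_linear_quadratic_form Z_finite_mean, symmetric])
    also have "\<dots> = (\<integral>T. h (x l \<omega>, T) \<partial>D)"
      unfolding h_def
      by (intro Bochner_Integration.integral_cong refl)
        (simp add: quadratic_form_ker_part transpose_sketch_Z[OF D_rows M_sym]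
          mult_sketch_Z[OF D_rows M_sym])
    finally have u: "?u \<bullet> (Z *v ?u) = (\<integral>T. h (x l \<omega>, T) \<partial>D)" .
    have "0 \<le> (\<integral>T. h (x l \<omega>, T) \<partial>D)"
      unfolding h_def prod.case
      by (intro Bochner_Integration.integral_nonneg sketch_Z_quadratic_nonneg[OF D_rows M_sym M_psd])
    thus ?thesis by (simp add: q_def mat_norm_def u)
  qed
  have q_int: "integrable \<Omega> (q l)"
    and q_integral: "(\<integral>\<omega>. q l \<omega> \<partial>\<Omega>) = (\<integral>\<omega>. h (x l \<omega>, S l \<omega>) \<partial>\<Omega>)" for l
  proof -
    \<comment> \<open>The current sketch is kept as a one-element family, so that past and present
      have the same type.\<close>
    let ?past = "\<lambda>\<omega>. restrict (\<lambda>i. S i \<omega>) {..<l}" and ?now = "\<lambda>\<omega>. restrict (\<lambda>i. S i \<omega>) {l}"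
    let ?P = "PiM {..<l} (\<lambda>_. D)" and ?N = "PiM {l} (\<lambda>_. D)"
    define h' where "h' = (\<lambda>p. h (\<Phi> l (fst p), snd p l))"
    have ind: "\<Omega>.indep_var ?P ?past ?N ?now"
      by (rule \<Omega>.indep_var_restrict[OF S_indep]) auto
    have 1: "(\<lambda>p. \<Phi> l (fst p)) \<in> borel_measurable (?P \<Otimes>\<^sub>M ?N)"
      by (rule measurable_compose[OF measurable_fst \<Phi>_meas])
    have 2: "(\<lambda>p. snd p l) \<in> measurable (?P \<Otimes>\<^sub>M ?N) D"
      by (rule measurable_compose[OF measurable_snd measurable_component_singleton]) simp
    have h'_meas: "h' \<in> borel_measurable (?P \<Otimes>\<^sub>M ?N)"
      unfolding h'_def by (rule measurable_compose[OF measurable_Pair[OF 1 2] h_meas])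
    have h'_eq: "h' (?past \<omega>, ?now \<omega>') = h (x l \<omega>, S l \<omega>')" for \<omega> \<omega>'
      by (simp add: h'_def x_\<Phi>)
    have inner: "(\<integral>\<omega>'. h (x l \<omega>, S l \<omega>') \<partial>\<Omega>) = q l \<omega>" for \<omega>
    proof -
      have "(\<lambda>T. h (x l \<omega>, T)) \<in> borel_measurable D"
        by (rule measurable_compose[OF measurable_Pair1' h_meas]) simp
      hence "(\<integral>T. h (x l \<omega>, T) \<partial>distr \<Omega> D (S l)) = (\<integral>\<omega>'. h (x l \<omega>, S l \<omega>') \<partial>\<Omega>)"
        by (rule integral_distr[OF S_meas])
      thus ?thesis by (simp add: S_distr q_eq)
    qed
    show "integrable \<Omega> (q l)" "(\<integral>\<omega>. q l \<omega> \<partial>\<Omega>) = (\<integral>\<omega>. h (x l \<omega>, S l \<omega>) \<partial>\<Omega>)"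
      using \<Omega>.integral_indep_var_freeze[OF ind h'_meas, unfolded h'_eq, OF h_int]
      unfolding inner by simp_all
  qed

  have q_le: "(\<integral>\<omega>. q l \<omega> \<partial>\<Omega>)
      \<le> 2 * ((\<integral>\<omega>. f (x l \<omega>) \<partial>\<Omega>) - (\<integral>\<omega>. f (x (Suc l) \<omega>) \<partial>\<Omega>))" for l
  proof -
    have "(\<integral>\<omega>. h (x l \<omega>, S l \<omega>) \<partial>\<Omega>)
        \<le> (\<integral>\<omega>. 2 * (f (x l \<omega>) - f (x (Suc l) \<omega>)) \<partial>\<Omega>)"
      by (intro integral_mono h_int integrable_mult_right
          Bochner_Integration.integrable_diff f_int descent)
    thus ?thesis by (simp add: q_integral f_int)
  qed
  let ?m = "MIN l\<in>{0..k-1}. \<integral>\<omega>. q l \<omega> \<partial>\<Omega>"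
  have "real k * ?m = (\<Sum>l<k. ?m)" by simp
  also have "\<dots> \<le> (\<Sum>l<k. \<integral>\<omega>. q l \<omega> \<partial>\<Omega>)"
    by (intro sum_mono Min_le) auto
  also have "\<dots> \<le> (\<Sum>l<k. 2 * ((\<integral>\<omega>. f (x l \<omega>) \<partial>\<Omega>) - (\<integral>\<omega>. f (x (Suc l) \<omega>) \<partial>\<Omega>)))"
    by (intro sum_mono q_le)
  also have "\<dots> = 2 * ((\<integral>\<omega>. f (x 0 \<omega>) \<partial>\<Omega>) - (\<integral>\<omega>. f (x k \<omega>) \<partial>\<Omega>))"
    using sum_lessThan_telescope'[of "\<lambda>l. \<integral>\<omega>. f (x l \<omega>) \<partial>\<Omega>" k]
    by (simp only: sum_distrib_left[symmetric])
  also have "\<dots> \<le> 2 * (f x0 - fbar)"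
  proof -
    have "(\<integral>\<omega>. fbar \<partial>\<Omega>) \<le> (\<integral>\<omega>. f (x k \<omega>) \<partial>\<Omega>)"
      by (intro integral_mono f_int f_bounded_below feasible) simp_all
    thus ?thesis by (simp add: x_def \<Omega>.prob_space)
  qed
  finally have "?m \<le> 2 * (f x0 - fbar) / real k"
    using k_ge_1 by (simp add: field_simps)
  thus ?thesis using q_int by (simp add: q_def[abs_def])
qed

end
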